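(* Let $Y$ be finite dimensional, $A$ be closed, $G$ be continuous on $A$ and $\mathscr{L}_e(\cdot,\cdot,c)$ be lower semicontinuous on $A\times\Lambda$ for all $c>0$. Suppose also that assumptions (A2), (A4)$_s$, (A6)$_s$ and (A12) listed in the context are satisfied, and $$\Phi(G(x_* ),\lambda_*,c)=0\quad\forall c>0\quad\forall(x_*,\lambda_* )\in\Omega_*\times\Lambda\ \text{ with }\ \eta(x_*,\lambda_* )=0.$$ Then $\mathscr{L}_e(x,\lambda,c)$ is globally exact (with respect to the function $\eta$) if and only if 1. there exists $(\overline{x},\overline{\lambda})\in\Omega_*\times\Lambda$ such that $\eta(\overline{x},\overline{\lambda})=0$; 2. $\mathscr{L}_e(x,\lambda,c)$ is locally exact at every $(x_*,\lambda_* )\in\Omega_*\times\Lambda$ such that $\eta(x_*,\lambda_* )=0$; 3. there exists $c_0>0$ such that the set $S_e(c_0):=\{(x,\lambda)\in A\times\Lambda\mid\mathscr{L}_e(x,\lambda,c_0)<f_*\}$ is either bounded or empty.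
   Context: Setting. $X$ is a finite dimensional normed space, $A\subseteq X$ is nonempty, $Y$ is a normed space with dual $Y^*$, $K\subseteq Y$ is a nonempty closed convex cone. $f:X\to\mathbb{R}\cup\{+\infty\}$, $G:X\to Y$. Problem $(\mathcal{P})$: minimize $f(x)$ subject to $G(x)\in K$, $x\in A$; there is a feasible point with $f(x)<+\infty$ and a globally optimal solution exists. $\Omega_*$ is the set of globally optimal solutions, $f_*$ the optimal value. $\Lambda\subseteq Y^*$ is a fixed closed convex cone. $\Phi:Y\times Y^*\times(0,+\infty)\to\mathbb{R}\cup\{+\infty\}$ and $\eta:X\times Y^*\to[0,+\infty]$ are given functions; the penalized augmented Lagrangian is $\mathscr{L}_e(x,\lambda,c)=f(x)+\Phi(G(x),\lambda,c)+\eta(x,\lambda)$. $B(\cdot,r)$ denotes closed balls. Assumptions: (A2) $\Phi(y,\lambda,c)\le 0$ for all $y\in K$, $\lambda\in\Lambda$, $c>0$. (A4)$_s$ for all $y\in Y$, $\lambda\in\Lambda$ the function $c\mapsto\Phi(y,\lambda,c)$ is non-decreasing, and for all $y\in Y$, $\lambda\in\Lambda$, $c>0$ with $\Phi(y,\lambda,c)<+\infty$ either $\Phi(y,\lambda,\cdot)$ is strictly increasing at $c$ (meaning $\Phi(y,\lambda,\tau)>\Phi(y,\lambda,c)$ for all $\tau>c$) or $\Phi(y,\lambda,c)=0$ and $y\in K$. (A6)$_s$ for all $y\notin K$, $\lambda\in\Lambda$, $c_0>0$ there is $r>0$ such that $\lim_{c\to\infty}\inf\{\Phi(z,\mu,c)-\Phi(z,\mu,c_0)\mid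 z\in B(y,r),\ \mu\in B(\lambda,r)\cap\Lambda,\ \Phi(z,\mu,c_0)<+\infty\}=+\infty$. (A12) for all $y\in K$, $\lambda\in\Lambda$ one has $\Phi(y,\lambda,c)\to 0$ as $c\to\infty$. Locally exact: for a locally optimal solution $x_*$ of $(\mathcal{P})$ and $\lambda_*\in\Lambda$ with $\eta(x_*,\lambda_* )=0$, $\mathscr{L}_e$ is locally exact at $(x_*,\lambda_* )$ if there are $c_0>0$ and a neighbourhood $U$ of $(x_*,\lambda_* )$ such that $\mathscr{L}_e(x,\lambda,c)\ge\mathscr{L}_e(x_*,\lambda_*,c)$ for all $(x,\lambda)\in U\cap(A\times\Lambda)$ and $c\ge c_0$. Globally exact (with respect to $\eta$): there is $c_0>0$ such that for any $c\ge c_0$ the function $\mathscr{L}_e(\cdot,\cdot,c)$ attains a global minimum on $A\times\Lambda$, and $(x_*,\lambda_* )\in\arg\min_{(x,\lambda)\in A\times\Lambda}\mathscr{L}_e(x,\lambda,c)$ if and only if $x_*\in\Omega_*$ and $\eta(x_*,\lambda_* )=0$ (for $(x_*,\lambda_* )\in A\times\Lambda$). *)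

theory Defs
  imports "HOL-Analysis.Analysis"
begin

(* An arbitrary norm is allowed, so finite dimensionality is a predicate on the type
   instead of the class euclidean_space, which would force an inner product norm. *)
definition finite_dimensional :: "'a::real_normed_vector itself \<Rightarrow> bool" where
  "finite_dimensional _ \<longleftrightarrow> (\<exists>B :: 'a set. finite B \<and> span B = UNIV)"

definition lsc_on :: "'a::topological_space set \<Rightarrow> ('a \<Rightarrow> ereal) \<Rightarrow> bool" where
  "lsc_on S h \<longleftrightarrow> (\<forall>x\<in>S. h x \<le> Liminf (at x within S) h)"

definition arg_min_set :: "('a \<Rightarrow> ereal) \<Rightarrow> 'a set \<Rightarrow> 'a set" where
  "arg_min_set h S = {x. is_arg_min h (\<lambda>z. z \<in> S) x}"

definition feasible_set :: "('x \<Rightarrow> 'y) \<Rightarrow> 'y set \<Rightarrow> 'x set \<Rightarrow> 'x set" where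
  "feasible_set G K A = {x \<in> A. G x \<in> K}"

definition opt_value :: "('x \<Rightarrow> ereal) \<Rightarrow> ('x \<Rightarrow> 'y) \<Rightarrow> 'y set \<Rightarrow> 'x set \<Rightarrow> ereal" where
  "opt_value f G K A = (INF x\<in>feasible_set G K A. f x)"

definition opt_solutions :: "('x \<Rightarrow> ereal) \<Rightarrow> ('x \<Rightarrow> 'y) \<Rightarrow> 'y set \<Rightarrow> 'x set \<Rightarrow> 'x set" where
  "opt_solutions f G K A = arg_min_set f (feasible_set G K A)"

(* In all definitions below, \<Phi> takes a real penalty parameter but is only ever
   constrained or evaluated at positive ones. *)

definition pen_aug_lagrangian ::
  "('x \<Rightarrow> ereal) \<Rightarrow> ('x \<Rightarrow> 'y) \<Rightarrow> ('y \<Rightarrow> 'd \<Rightarrow> real \<Rightarrow> ereal) \<Rightarrow> ('x \<Rightarrow> 'd \<Rightarrow> ereal)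
    \<Rightarrow> 'x \<Rightarrow> 'd \<Rightarrow> real \<Rightarrow> ereal" where
  "pen_aug_lagrangian f G \<Phi> \<eta> x l c = f x + \<Phi> (G x) l c + \<eta> x l"

definition assm_A2 :: "'y set \<Rightarrow> 'd set \<Rightarrow> ('y \<Rightarrow> 'd \<Rightarrow> real \<Rightarrow> ereal) \<Rightarrow> bool" where
  "assm_A2 K \<Lambda> \<Phi> \<longleftrightarrow> (\<forall>y\<in>K. \<forall>l\<in>\<Lambda>. \<forall>c>0. \<Phi> y l c \<le> 0)"

definition assm_A4s :: "'y set \<Rightarrow> 'd set \<Rightarrow> ('y \<Rightarrow> 'd \<Rightarrow> real \<Rightarrow> ereal) \<Rightarrow> bool" where
  "assm_A4s K \<Lambda> \<Phi> \<longleftrightarrow>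
    (\<forall>y. \<forall>l\<in>\<Lambda>. mono_on {0<..} (\<Phi> y l)) \<and>
    (\<forall>y. \<forall>l\<in>\<Lambda>. \<forall>c>0. \<Phi> y l c < \<infinity> \<longrightarrow>
      (\<forall>\<tau>>c. \<Phi> y l \<tau> > \<Phi> y l c) \<or> (\<Phi> y l c = 0 \<and> y \<in> K))"

(* The subtrahend is finite on the set over which the infimum is taken whenever
   \<Phi> never takes the value -\<infinity>; the infimum over the empty set is \<infinity>. *)
definition assm_A6s ::
  "'y::metric_space set \<Rightarrow> 'd::metric_space set \<Rightarrow> ('y \<Rightarrow> 'd \<Rightarrow> real \<Rightarrow> ereal) \<Rightarrow> bool" where
  "assm_A6s K \<Lambda> \<Phi> \<longleftrightarrow>
    (\<forall>y. y \<notin> K \<longrightarrow> (\<forall>l\<in>\<Lambda>. \<forall>c0>0. \<exists>r>0.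
      ((\<lambda>c. Inf {\<Phi> z m c - \<Phi> z m c0 | z m.
          z \<in> cball y r \<and> m \<in> cball l r \<inter> \<Lambda> \<and> \<Phi> z m c0 < \<infinity>}) \<longlongrightarrow> \<infinity>) at_top))"

definition assm_A12 :: "'y set \<Rightarrow> 'd set \<Rightarrow> ('y \<Rightarrow> 'd \<Rightarrow> real \<Rightarrow> ereal) \<Rightarrow> bool" where
  "assm_A12 K \<Lambda> \<Phi> \<longleftrightarrow> (\<forall>y\<in>K. \<forall>l\<in>\<Lambda>. (\<Phi> y l \<longlongrightarrow> 0) at_top)"

(* Meant for a locally optimal xs and ls \<in> \<Lambda> with \<eta> xs ls = 0. *)
definition locally_exact ::
  "('x::topological_space \<Rightarrow> 'd::topological_space \<Rightarrow> real \<Rightarrow> ereal) \<Rightarrow> 'x set \<Rightarrow> 'd set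
    \<Rightarrow> 'x \<Rightarrow> 'd \<Rightarrow> bool" where
  "locally_exact L A \<Lambda> xs ls \<longleftrightarrow>
    (\<exists>c0>0. \<exists>U. open U \<and> (xs, ls) \<in> U \<and>
      (\<forall>(x, l) \<in> U \<inter> (A \<times> \<Lambda>). \<forall>c\<ge>c0. L x l c \<ge> L xs ls c))"

definition globally_exact ::
  "('x \<Rightarrow> 'd \<Rightarrow> real \<Rightarrow> ereal) \<Rightarrow> 'x set \<Rightarrow> 'd set \<Rightarrow> 'x set \<Rightarrow> ('x \<Rightarrow> 'd \<Rightarrow> ereal) \<Rightarrow> bool" where
  "globally_exact L A \<Lambda> \<Omega> \<eta> \<longleftrightarrow>
    (\<exists>c0>0. \<forall>c\<ge>c0.
      arg_min_set (\<lambda>(x, l). L x l c) (A \<times> \<Lambda>) \<noteq> {} \<and>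
      (\<forall>xs\<in>A. \<forall>ls\<in>\<Lambda>.
        (xs, ls) \<in> arg_min_set (\<lambda>(x, l). L x l c) (A \<times> \<Lambda>) \<longleftrightarrow> xs \<in> \<Omega> \<and> \<eta> xs ls = 0))"

definition sublevel_e ::
  "('x \<Rightarrow> 'd \<Rightarrow> real \<Rightarrow> ereal) \<Rightarrow> 'x set \<Rightarrow> 'd set \<Rightarrow> ereal \<Rightarrow> real \<Rightarrow> ('x \<times> 'd) set" where
  "sublevel_e L A \<Lambda> v c = {(x, l) \<in> A \<times> \<Lambda>. L x l c < v}"

end

theory Submission
  imports Defs
begin

text \<open>
  For the nontrivial direction it suffices that \<open>S\<^sub>e(c)\<close> is empty for some \<open>c\<close>: beyond that \<open>c\<close>
  the strict monotonicity of \<open>\<Phi>\<close> in the penalty parameter forces every minimizer to be an optimal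
  solution with \<open>\<eta> = 0\<close>. If no \<open>S\<^sub>e(c)\<close> were empty, points \<open>p\<^sub>n \<in> S\<^sub>e(c\<^sub>0 + n)\<close> would form a bounded
  sequence, hence cluster at some \<open>p\<close>. By lower semicontinuity the Lagrangian at \<open>p\<close> is at most
  \<open>f\<^sub>*\<close> for every \<open>c\<close>, and letting \<open>c \<rightarrow> \<infinity>\<close>, (A6) makes \<open>p\<close> feasible and (A12) makes it
  optimal with \<open>\<eta> = 0\<close>. Local exactness at \<open>p\<close> then contradicts \<open>p\<^sub>n \<in> S\<^sub>e(c\<^sub>0 + n)\<close>.
\<close>

section \<open>Sequential compactness and continuity of coordinates in finite dimensional normed
  spaces\<close>

text \<open>The complement of a closed subspace is open, so \<open>b\<close> keeps a distance
  \<open>d\<close> from it; homogeneity extends this to all multiples of \<open>b\<close>. It serves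
  to control the \<open>b\<close>-coordinate of a vector by its norm.\<close>

lemma separated_from_hyperplane:
  fixes b :: "'a::real_normed_vector"
  assumes "closed (span B)" "b \<notin> span B"
  obtains d where "d > 0" "\<And>a s. s \<in> span B \<Longrightarrow> \<bar>a\<bar> * d \<le> norm (a *\<^sub>R b + s)"
proof -
  obtain d where "d > 0" "ball b d \<subseteq> - span B"
    using assms open_contains_ball[of "- span B"] by (auto simp: open_Compl)
  then have d: "d > 0" "\<And>y. y \<in> span B \<Longrightarrow> d \<le> dist b y"
    by (auto simp: subset_iff not_less[symmetric])
  have "\<bar>a\<bar> * d \<le> norm (a *\<^sub>R b + s)" if s: "s \<in> span B" for a s
  proof (cases "a = 0")
    case False
    have "d \<le> dist b (- (1 / a) *\<^sub>R s)"
      using d(2) s by (meson span_scale)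
    then have "\<bar>a\<bar> * d \<le> \<bar>a\<bar> * norm (b + (1 / a) *\<^sub>R s)"
      by (simp add: dist_norm mult_left_mono)
    also have "\<dots> = norm (a *\<^sub>R (b + (1 / a) *\<^sub>R s))"
      by simp
    also have "a *\<^sub>R (b + (1 / a) *\<^sub>R s) = a *\<^sub>R b + s"
      using False by (simp add: scaleR_add_right)
    finally show ?thesis .
  qed simp
  with d(1) show ?thesis using that by blast
qed

text \<open>A convergent sequence is bounded, and its limit is also that of the subsequence
  converging inside \<open>S\<close>.\<close>

lemma closed_if_bounded_seqs_converge:
  fixes S :: "'a::real_normed_vector set"
  assumes "\<And>x :: nat \<Rightarrow> 'a. range x \<subseteq> S \<Longrightarrow> bounded (range x) \<Longrightarrow>
    \<exists>l\<in>S. \<exists>r. strict_mono r \<and> (x \<circ> r) \<longlonglongrightarrow> l"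
  shows "closed S"
  unfolding closed_sequential_limits
proof (intro allI impI, elim conjE)
  fix x l
  assume x: "\<forall>n. x n \<in> S" "x \<longlonglongrightarrow> l"
  have "bounded (range x)"
    using x(2) convergent_imp_bounded by blast
  then obtain l' r where "l' \<in> S" "strict_mono (r :: nat \<Rightarrow> nat)" "(x \<circ> r) \<longlonglongrightarrow> l'"
    using assms[of x] x(1) by blast
  then show "l \<in> S"
    using x(2) LIMSEQ_subseq_LIMSEQ LIMSEQ_unique by metis
qed

text \<open>Bolzano-Weierstrass for an arbitrary norm, by induction on the spanning set: split off
  the \<open>b\<close>-coordinate, show that coordinate and remainder stay bounded, and extract
  subsequences one after the other.\<close>

lemma bounded_seq_in_finite_span_converges:
  fixes x :: "nat \<Rightarrow> 'a::real_normed_vector"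
  assumes "finite B" "range x \<subseteq> span B" "bounded (range x)"
  shows "\<exists>l\<in>span B. \<exists>r. strict_mono r \<and> (x \<circ> r) \<longlonglongrightarrow> l"
  using assms
proof (induction B arbitrary: x rule: finite_induct)
  case empty
  then have "x = (\<lambda>_. 0)" by auto
  then show ?case using strict_mono_id by (auto simp: o_def)
next
  case (insert b B)
  show ?case
  proof (cases "b \<in> span B")
    case True
    then show ?thesis using insert by (simp add: span_redundant)
  next
    case False
    \<comment> \<open>The induction hypothesis itself supplies the closedness that separates
      \<open>b\<close> from the smaller span.\<close>
    have "closed (span B)"
      by (rule closed_if_bounded_seqs_converge) (rule insert.IH)
    then obtain d where d: "d > 0"
      "\<And>a s. s \<in> span B \<Longrightarrow> \<bar>a\<bar> * d \<le> norm (a *\<^sub>R b + s)"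
      using separated_from_hyperplane False by blast
    have "\<forall>n. \<exists>k. x n - k *\<^sub>R b \<in> span B"
      using insert.prems(1) by (simp add: image_subset_iff span_breakdown_eq)
    then obtain a where a: "\<And>n. x n - a n *\<^sub>R b \<in> span B"
      by metis
    define s where "s n = x n - a n *\<^sub>R b" for n
    obtain M where M: "\<And>n. norm (x n) \<le> M"
      using insert.prems(2) by (auto simp: bounded_iff)
    have a_le: "\<bar>a n\<bar> \<le> M / d" for n
    proof -
      have "\<bar>a n\<bar> * d \<le> norm (x n)"
        using d(2)[OF a[of n], of "a n"] by simp
      then show ?thesis
        using M[of n] d(1) by (simp add: pos_le_divide_eq)
    qed
    then have "bounded (range a)"
      by (auto simp: bounded_iff)
    then obtain a' r where r: "strict_mono r" "(a \<circ> r) \<longlonglongrightarrow> a'"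
      using bounded_imp_convergent_subsequence by blast
    have "norm (s n) \<le> M + M / d * norm b" for n
    proof -
      have "norm (s n) \<le> norm (x n) + norm (a n *\<^sub>R b)"
        unfolding s_def by (rule norm_triangle_ineq4)
      also have "\<dots> \<le> M + M / d * norm b"
        using add_mono[OF M[of n] mult_right_mono[OF a_le[of n] norm_ge_zero[of b]]] by simp
      finally show ?thesis .
    qed
    then have "bounded (range (s \<circ> r))"
      by (auto simp: bounded_iff)
    moreover have "range (s \<circ> r) \<subseteq> span B"
      using a by (auto simp: s_def)
    ultimately obtain s' q where q: "s' \<in> span B" "strict_mono q" "((s \<circ> r) \<circ> q) \<longlonglongrightarrow> s'"
      using insert.IH by blast
    \<comment> \<open>Thinning by \<open>q\<close> preserves the limit of the coordinates, so both
      parts converge along \<open>r \<circ> q\<close>.\<close>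
    have "((a \<circ> r) \<circ> q) \<longlonglongrightarrow> a'"
      using r(2) q(2) LIMSEQ_subseq_LIMSEQ by blast
    then have "(\<lambda>n. ((a \<circ> r) \<circ> q) n *\<^sub>R b + ((s \<circ> r) \<circ> q) n) \<longlonglongrightarrow> a' *\<^sub>R b + s'"
      using q(3) by (intro tendsto_intros)
    then have "(x \<circ> (r \<circ> q)) \<longlonglongrightarrow> a' *\<^sub>R b + s'"
      by (simp add: s_def o_def)
    moreover have "a' *\<^sub>R b + s' \<in> span (insert b B)"
      using q(1) by (auto simp: span_breakdown_eq intro!: exI[of _ a'])
    ultimately show ?thesis
      using r(1) q(2) strict_mono_o by blast
  qed
qed

lemma finite_dimensional_bounded_seq:
  fixes x :: "nat \<Rightarrow> 'a::real_normed_vector"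
  assumes "finite_dimensional TYPE('a)" "bounded (range x)"
  obtains l r where "strict_mono r" "(x \<circ> r) \<longlonglongrightarrow> l"
  using assms bounded_seq_in_finite_span_converges[of _ x]
  unfolding finite_dimensional_def by (metis subset_UNIV)

text \<open>The remaining basis vectors span a closed subspace missing \<open>b\<close>; its
  distance \<open>d\<close> from \<open>b\<close> gives the operator bound
  \<open>1 / d\<close>.\<close>

lemma bounded_linear_representation:
  fixes B :: "'a::real_normed_vector set"
  assumes "finite B" "independent B" "span B = UNIV" "b \<in> B"
  shows "bounded_linear (\<lambda>v. representation B v b)"
proof -
  define C where "C = B - {b}"
  have "closed (span C)"
    using assms(1) unfolding C_def
    by (intro closed_if_bounded_seqs_converge bounded_seq_in_finite_span_converges) auto
  moreover have "b \<notin> span C"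
    using assms(2,4) unfolding C_def dependent_def by blast
  ultimately obtain d where d: "d > 0"
    "\<And>a s. s \<in> span C \<Longrightarrow> \<bar>a\<bar> * d \<le> norm (a *\<^sub>R b + s)"
    using separated_from_hyperplane by blast
  have bound: "\<bar>representation B v b\<bar> \<le> norm v * (1 / d)" for v
  proof -
    have "v = (\<Sum>c\<in>B. representation B v c *\<^sub>R c)"
      using real_vector.sum_representation_eq[of B v B] assms by simp
    also have "\<dots> = representation B v b *\<^sub>R b + (\<Sum>c\<in>C. representation B v c *\<^sub>R c)"
      using assms(1,4) by (simp add: sum.remove C_def)
    finally have v: "v = representation B v b *\<^sub>R b + (\<Sum>c\<in>C. representation B v c *\<^sub>R c)" .
    have "(\<Sum>c\<in>C. representation B v c *\<^sub>R c) \<in> span C"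
      by (intro span_sum span_scale span_base)
    then have "\<bar>representation B v b\<bar> * d \<le> norm v"
      using d(2)[of _ "representation B v b"] by (subst v)
    then show ?thesis
      using d(1) by (simp add: pos_le_divide_eq)
  qed
  show ?thesis
    by (rule bounded_linear_intro[where K = "1 / d"])
      (use assms bound in \<open>auto simp: real_vector.representation_add real_vector.representation_scale\<close>)
qed

text \<open>The coordinate functionals of a basis span the dual; their continuity comes from the
  closedness of finite-dimensional subspaces.\<close>
lemma finite_dimensional_dual:
  assumes "finite_dimensional TYPE('a::real_normed_vector)"
  shows "finite_dimensional TYPE('a \<Rightarrow>\<^sub>L real)"
proof -
  obtain S :: "'a set" where S: "finite S" "span S = UNIV"
    using assms unfolding finite_dimensional_def by blast
  obtain B where B: "B \<subseteq> S" "independent B" "S \<subseteq> span B"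
    using real_vector.maximal_independent_subset by blast
  have fin: "finite B"
    using B(1) S(1) finite_subset by blast
  have span: "span B = UNIV"
    using B(3) S(2) by (metis span_minimal subspace_span top.extremum_unique)
  define e where "e b = Blinfun (\<lambda>v. representation B v b)" for b
  have e: "blinfun_apply (e b) v = representation B v b" if "b \<in> B" for b v
    unfolding e_def
    by (simp add: bounded_linear_Blinfun_apply bounded_linear_representation[OF fin B(2) span that])
  have "l \<in> span (e ` B)" for l :: "'a \<Rightarrow>\<^sub>L real"
  proof -
    \<comment> \<open>Expansion of \<open>l\<close> in the dual basis: its coefficients are its
      values on the basis vectors.\<close>
    have "l = (\<Sum>b\<in>B. l b *\<^sub>R e b)"
    proof (rule blinfun_eqI)
      fix v
      have "blinfun_apply l v = l (\<Sum>b\<in>B. representation B v b *\<^sub>R b)"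
        using real_vector.sum_representation_eq[of B v B] fin B(2) span by simp
      also have "\<dots> = (\<Sum>b\<in>B. representation B v b * l b)"
        by (simp add: blinfun.sum_right blinfun.scaleR_right)
      also have "\<dots> = blinfun_apply (\<Sum>b\<in>B. l b *\<^sub>R e b) v"
        by (simp add: blinfun.sum_left blinfun.scaleR_left e mult.commute)
      finally show "blinfun_apply l v = blinfun_apply (\<Sum>b\<in>B. l b *\<^sub>R e b) v" .
    qed
    also have "\<dots> \<in> span (e ` B)"
      by (intro span_sum span_scale span_base) auto
    finally show ?thesis .
  qed
  then show ?thesis
    unfolding finite_dimensional_def using fin by blast
qed

section \<open>Lower semicontinuity along sequences, and growth of the penalty term\<close>

lemma lsc_on_le_of_seq:
  assumes "lsc_on S h" "x \<longlonglongrightarrow> p" "p \<in> S"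
    and "\<forall>\<^sub>F n in sequentially. x n \<in> S \<and> h (x n) \<le> b"
  shows "h p \<le> b"
proof (rule ccontr)
  assume "\<not> h p \<le> b"
  then have lt: "b < h p" by simp
  have "h p \<le> Liminf (at p within S) h"
    using assms(1,3) unfolding lsc_on_def by blast
  then have "\<forall>\<^sub>F z in at p within S. b < h z"
    using lt by (simp add: le_Liminf_iff)
  \<comment> \<open>\<open>at p within S\<close> omits \<open>p\<close>, which the sequence may hit;
    at \<open>p\<close> itself the inequality is \<open>lt\<close>.\<close>
  then have "\<forall>\<^sub>F z in nhds p. z \<in> S \<longrightarrow> b < h z"
    unfolding eventually_at_filter by (rule eventually_mono) (use lt in auto)
  then have "\<forall>\<^sub>F n in sequentially. x n \<in> S \<longrightarrow> b < h (x n)"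
    using assms(2) unfolding filterlim_iff by blast
  with assms(4) have "\<forall>\<^sub>F n in sequentially. False"
    by eventually_elim auto
  then show False by simp
qed

text \<open>The centre \<open>(y, l)\<close> competes in the infimum of (A6)\<open>\<^sub>s\<close>,
  so its own increment over \<open>c0\<close> tends to \<infinity>.\<close>

lemma A6s_infeasible_unbounded:
  assumes A6: "assm_A6s K \<Lambda> \<Phi>" and "y \<notin> K" "l \<in> \<Lambda>" "c0 > 0"
    and fin: "\<Phi> y l c0 = ereal p"
  obtains c where "c > 0" "\<Phi> y l c > ereal M"
proof -
  obtain r where r: "r > 0" "((\<lambda>c. Inf {\<Phi> z m c - \<Phi> z m c0 | z m.
      z \<in> cball y r \<and> m \<in> cball l r \<inter> \<Lambda> \<and> \<Phi> z m c0 < \<infinity>}) \<longlongrightarrow> \<infinity>) at_top"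
    using A6 assms(2-4) unfolding assm_A6s_def by blast
  let ?D = "\<lambda>c. {\<Phi> z m c - \<Phi> z m c0 | z m.
      z \<in> cball y r \<and> m \<in> cball l r \<inter> \<Lambda> \<and> \<Phi> z m c0 < \<infinity>}"
  \<comment> \<open>An increment above \<open>M - p\<close> lifts the value \<open>p\<close> at
    \<open>c0\<close> above \<open>M\<close>.\<close>
  have "\<forall>\<^sub>F c in at_top. ereal (M - p) < Inf (?D c)"
    using r(2) unfolding tendsto_PInfty by blast
  then have "\<forall>\<^sub>F c in at_top. c > 0 \<and> ereal (M - p) < Inf (?D c)"
    using eventually_gt_at_top by (rule eventually_conj[rotated])
  then obtain c where c: "c > 0" "ereal (M - p) < Inf (?D c)"
    using eventually_happens[of _ "at_top :: real filter"] by (auto simp: trivial_limit_at_top_linorder)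
  have "y \<in> cball y r \<and> l \<in> cball l r \<inter> \<Lambda> \<and> \<Phi> y l c0 < \<infinity>"
    using r(1) assms(3) fin by simp
  then have "\<Phi> y l c - \<Phi> y l c0 \<in> ?D c"
    by blast
  with c(2) have "ereal (M - p) < \<Phi> y l c - \<Phi> y l c0"
    by (rule order_less_le_trans[OF _ Inf_lower])
  then have "ereal M < \<Phi> y l c"
    unfolding fin by (cases "\<Phi> y l c") auto
  then show ?thesis using that c(1) by blast
qed

text \<open>With -\<infinity> excluded, one infinite summand would make the sum \<infinity>. This
  moves bounds on the Lagrangian into real arithmetic.\<close>

lemma ereal_sum3_le_real:
  fixes a b e :: ereal
  assumes "a + b + e \<le> ereal v" "a \<noteq> -\<infinity>" "b \<noteq> -\<infinity>" "e \<ge> 0"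
  obtains a' b' e' where "a = ereal a'" "b = ereal b'" "e = ereal e'" "e' \<ge> 0" "a' + b' + e' \<le> v"
  using assms by (cases a; cases b; cases e) auto

section \<open>Global exactness via local exactness and bounded sublevel sets\<close>

theorem theorem6:
  fixes f :: "'x::real_normed_vector \<Rightarrow> ereal"
    and G :: "'x \<Rightarrow> 'y::real_normed_vector"
    and A :: "'x set" and K :: "'y set"
    and \<Lambda> :: "('y \<Rightarrow>\<^sub>L real) set"
    and \<Phi> :: "'y \<Rightarrow> ('y \<Rightarrow>\<^sub>L real) \<Rightarrow> real \<Rightarrow> ereal"
    and \<eta> :: "'x \<Rightarrow> ('y \<Rightarrow>\<^sub>L real) \<Rightarrow> ereal"
  defines "L \<equiv> pen_aug_lagrangian f G \<Phi> \<eta>"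
    and "\<Omega> \<equiv> opt_solutions f G K A"
    and "fopt \<equiv> opt_value f G K A"
  assumes "finite_dimensional TYPE('x)" and "finite_dimensional TYPE('y)"
    and "A \<noteq> {}" and "closed A"
    and "K \<noteq> {}" and "closed K" and "convex K" and "cone K"
    and "closed \<Lambda>" and "convex \<Lambda>" and "cone \<Lambda>"
    and "\<And>x. f x \<noteq> -\<infinity>"
    and "\<And>y l c. c > 0 \<Longrightarrow> \<Phi> y l c \<noteq> -\<infinity>"
    and "\<And>x l. \<eta> x l \<ge> 0"
    and "\<exists>x\<in>feasible_set G K A. f x < \<infinity>"
    and "\<Omega> \<noteq> {}"
    and "continuous_on A G"
    and "\<And>c. c > 0 \<Longrightarrow> lsc_on (A \<times> \<Lambda>) (\<lambda>(x, l). L x l c)"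
    and "assm_A2 K \<Lambda> \<Phi>" and "assm_A4s K \<Lambda> \<Phi>" and "assm_A6s K \<Lambda> \<Phi>" and "assm_A12 K \<Lambda> \<Phi>"
    and "\<And>c xs ls. c > 0 \<Longrightarrow> xs \<in> \<Omega> \<Longrightarrow> ls \<in> \<Lambda> \<Longrightarrow> \<eta> xs ls = 0 \<Longrightarrow> \<Phi> (G xs) ls c = 0"
  shows "globally_exact L A \<Lambda> \<Omega> \<eta> \<longleftrightarrow>
    (\<exists>xs\<in>\<Omega>. \<exists>ls\<in>\<Lambda>. \<eta> xs ls = 0) \<and>
    (\<forall>xs\<in>\<Omega>. \<forall>ls\<in>\<Lambda>. \<eta> xs ls = 0 \<longrightarrow> locally_exact L A \<Lambda> xs ls) \<and>
    (\<exists>c0>0. bounded (sublevel_e L A \<Lambda> fopt c0) \<or> sublevel_e L A \<Lambda> fopt c0 = {})"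
proof
  note X_fin = assms(4) and Y_fin = assms(5) and A_closed = assms(7) and \<Lambda>_closed = assms(12)
    and f_ninf = assms(15) and \<Phi>_ninf = assms(16) and \<eta>_nonneg = assms(17)
    and feas = assms(18) and \<Omega>_ne = assms(19) and lsc = assms(21)
    and A4 = assms(23) and A6 = assms(24) and A12 = assms(25) and \<Phi>_zero = assms(26)
  have L_eq: "L x l c = f x + \<Phi> (G x) l c + \<eta> x l" for x l c
    unfolding L_def pen_aug_lagrangian_def ..
  have fopt_le: "fopt \<le> f x" if "x \<in> A" "G x \<in> K" for x
    unfolding fopt_def opt_value_def feasible_set_def using that by (auto intro: INF_lower)
  have \<Omega>_iff: "x \<in> \<Omega> \<longleftrightarrow> x \<in> A \<and> G x \<in> K \<and> f x = fopt" for x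
  proof
    assume "x \<in> \<Omega>"
    then have x: "x \<in> feasible_set G K A" "\<And>z. z \<in> feasible_set G K A \<Longrightarrow> f x \<le> f z"
      unfolding \<Omega>_def opt_solutions_def arg_min_set_def is_arg_min_def by (auto simp: not_less)
    then have "f x \<le> fopt"
      unfolding fopt_def opt_value_def by (auto intro: INF_greatest)
    with x(1) fopt_le show "x \<in> A \<and> G x \<in> K \<and> f x = fopt"
      by (force simp: feasible_set_def intro: antisym)
  next
    assume "x \<in> A \<and> G x \<in> K \<and> f x = fopt"
    then show "x \<in> \<Omega>"
      using fopt_le unfolding \<Omega>_def opt_solutions_def arg_min_set_def is_arg_min_def
      by (auto simp: feasible_set_def not_less)
  qed
  \<comment> \<open>The optimal value is attained by \<open>f\<close>, which avoids -\<infinity>; a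
    feasible point of finite value then makes it real.\<close>
  have "fopt \<noteq> -\<infinity>"
    using \<Omega>_ne \<Omega>_iff f_ninf by (metis all_not_in_conv)
  moreover have "fopt < \<infinity>"
    using feas fopt_le by (force simp: feasible_set_def)
  ultimately obtain v where v: "fopt = ereal v"
    by (cases fopt) auto
  have L_opt: "L x l c = fopt" if "x \<in> \<Omega>" "l \<in> \<Lambda>" "\<eta> x l = 0" "c > 0" for x l c
    using that \<Phi>_zero \<Omega>_iff by (simp add: L_eq)
  have L_mono: "L x l c \<le> L x l c'" if "l \<in> \<Lambda>" "0 < c" "c \<le> c'" for x l c c'
  proof -
    have "\<Phi> (G x) l c \<le> \<Phi> (G x) l c'"
      using A4 that unfolding assm_A4s_def mono_on_def by auto
    then show ?thesis
      unfolding L_eq by (intro add_mono) auto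
  qed
  have argmin_iff: "(x, l) \<in> arg_min_set (\<lambda>(x, l). L x l c) (A \<times> \<Lambda>) \<longleftrightarrow>
      x \<in> A \<and> l \<in> \<Lambda> \<and> (\<forall>x'\<in>A. \<forall>l'\<in>\<Lambda>. L x l c \<le> L x' l' c)" for x l c
    unfolding arg_min_set_def is_arg_min_def by (auto simp: not_less)

  \<comment> \<open>Necessity of the three conditions\<close>
  {
    assume "globally_exact L A \<Lambda> \<Omega> \<eta>"
    then obtain c0 where c0: "c0 > 0"
      "\<And>c. c \<ge> c0 \<Longrightarrow> arg_min_set (\<lambda>(x, l). L x l c) (A \<times> \<Lambda>) \<noteq> {}"
      "\<And>c x l. c \<ge> c0 \<Longrightarrow> x \<in> A \<Longrightarrow> l \<in> \<Lambda> \<Longrightarrow>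
        (x, l) \<in> arg_min_set (\<lambda>(x, l). L x l c) (A \<times> \<Lambda>) \<longleftrightarrow> x \<in> \<Omega> \<and> \<eta> x l = 0"
      unfolding globally_exact_def by blast
    obtain xb lb where "(xb, lb) \<in> arg_min_set (\<lambda>(x, l). L x l c0) (A \<times> \<Lambda>)"
      using c0(2)[of c0] by auto
    then have b: "xb \<in> \<Omega>" "lb \<in> \<Lambda>" "\<eta> xb lb = 0"
      using c0(3)[of c0 xb lb] argmin_iff by auto
    have min: "L xs ls c \<le> L x l c"
      if "xs \<in> \<Omega>" "ls \<in> \<Lambda>" "\<eta> xs ls = 0" "c \<ge> c0" "x \<in> A" "l \<in> \<Lambda>" for xs ls x l c
      using that c0(3)[of c xs ls] argmin_iff \<Omega>_iff by blast
    \<comment> \<open>Global minimality allows the whole space as the neighbourhood.\<close>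
    have "locally_exact L A \<Lambda> xs ls" if "xs \<in> \<Omega>" "ls \<in> \<Lambda>" "\<eta> xs ls = 0" for xs ls
      unfolding locally_exact_def using c0(1) min[OF that]
      by (intro exI[of _ c0] conjI exI[of _ UNIV]) auto
    \<comment> \<open>The minimum value is \<open>fopt\<close> by \<open>L_opt\<close>, so nothing
      lies strictly below it.\<close>
    moreover have "sublevel_e L A \<Lambda> fopt c0 = {}"
      using min[OF b order.refl] L_opt[OF b c0(1)] by (force simp: sublevel_e_def)
    ultimately show "(\<exists>xs\<in>\<Omega>. \<exists>ls\<in>\<Lambda>. \<eta> xs ls = 0) \<and>
      (\<forall>xs\<in>\<Omega>. \<forall>ls\<in>\<Lambda>. \<eta> xs ls = 0 \<longrightarrow> locally_exact L A \<Lambda> xs ls) \<and>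
      (\<exists>c0>0. bounded (sublevel_e L A \<Lambda> fopt c0) \<or> sublevel_e L A \<Lambda> fopt c0 = {})"
      using b c0(1) by blast
  }

  \<comment> \<open>Sufficiency: emptiness of some sublevel set\<close>
  assume R: "(\<exists>xs\<in>\<Omega>. \<exists>ls\<in>\<Lambda>. \<eta> xs ls = 0) \<and>
      (\<forall>xs\<in>\<Omega>. \<forall>ls\<in>\<Lambda>. \<eta> xs ls = 0 \<longrightarrow> locally_exact L A \<Lambda> xs ls) \<and>
      (\<exists>c0>0. bounded (sublevel_e L A \<Lambda> fopt c0) \<or> sublevel_e L A \<Lambda> fopt c0 = {})"
  then obtain xb lb where b: "xb \<in> \<Omega>" "lb \<in> \<Lambda>" "\<eta> xb lb = 0"
    by blast
  have limit_optimal: "x \<in> \<Omega> \<and> \<eta> x l = 0"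
    if "x \<in> A" "l \<in> \<Lambda>" and le: "\<And>c. c > 0 \<Longrightarrow> L x l c \<le> fopt" for x l
  proof -
    have fin: "\<exists>a p e. f x = ereal a \<and> \<Phi> (G x) l c = ereal p \<and> \<eta> x l = ereal e \<and> e \<ge> 0 \<and> a + p + e \<le> v"
      if "c > 0" for c
      using ereal_sum3_le_real[OF le[OF that, unfolded L_eq v] f_ninf \<Phi>_ninf[OF that] \<eta>_nonneg]
      by metis
    \<comment> \<open>The parameter 1 is an arbitrary reference for (A6)\<open>\<^sub>s\<close>.
      Only \<open>\<Phi>\<close> depends on \<open>c\<close>, so \<open>a\<close> and
      \<open>e\<close> serve every \<open>c\<close> and \<open>\<Phi>\<close> gets a bound uniform
      in \<open>c\<close>.\<close>
    from fin[of 1] obtain a p e where ape: "f x = ereal a" "\<Phi> (G x) l 1 = ereal p" "\<eta> x l = ereal e" "e \<ge> 0"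
      by auto
    have \<Phi>_le: "\<Phi> (G x) l c \<le> ereal (v - a - e)" if "c > 0" for c
      using fin[OF that] ape by auto
    have G: "G x \<in> K"
    proof (rule ccontr)
      assume "G x \<notin> K"
      then obtain c where "c > 0" "\<Phi> (G x) l c > ereal (v - a - e)"
        using A6s_infeasible_unbounded[OF A6 _ \<open>l \<in> \<Lambda>\<close> zero_less_one ape(2)] by blast
      with \<Phi>_le show False by (simp add: leD)
    qed
    then have "(\<Phi> (G x) l \<longlongrightarrow> 0) at_top"
      using A12 \<open>l \<in> \<Lambda>\<close> unfolding assm_A12_def by blast
    \<comment> \<open>The uniform bound survives the limit in (A12); \<open>a + e \<le> v\<close>
      with \<open>v \<le> a\<close> and \<open>e \<ge> 0\<close> then forces equalities.\<close>
    then have "0 \<le> ereal (v - a - e)"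
      by (rule tendsto_upperbound)
        (auto intro: eventually_mono[OF eventually_gt_at_top[of 0]] \<Phi>_le)
    moreover have "v \<le> a"
      using fopt_le[OF \<open>x \<in> A\<close> G] v ape by simp
    ultimately have "e = 0" "a = v"
      using ape(4) by auto
    then show ?thesis
      using \<Omega>_iff \<open>x \<in> A\<close> G ape v by simp
  qed
  have "\<exists>c>0. sublevel_e L A \<Lambda> fopt c = {}"
  proof (rule ccontr)
    assume contra: "\<not> ?thesis"
    \<comment> \<open>\<open>contra\<close> rules out the empty alternative in
      \<open>R\<close>.\<close>
    then obtain c0 where c0: "c0 > 0" "bounded (sublevel_e L A \<Lambda> fopt c0)"
      using R by blast
    have "\<forall>n. \<exists>p. p \<in> sublevel_e L A \<Lambda> fopt (c0 + real n)"
      using contra c0(1) by (metis add_pos_nonneg all_not_in_conv of_nat_0_le_iff)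
    then obtain p where p: "\<And>n. p n \<in> sublevel_e L A \<Lambda> fopt (c0 + real n)"
      by metis
    define x where "x n = fst (p n)" for n
    define l where "l n = snd (p n)" for n
    have xl: "x n \<in> A" "l n \<in> \<Lambda>" "L (x n) (l n) (c0 + real n) < fopt" for n
      using p[of n] by (auto simp: x_def l_def sublevel_e_def)
    \<comment> \<open>Monotonicity in \<open>c\<close> nests the sublevel sets, so all
      \<open>p n\<close> lie in the bounded one for \<open>c0\<close>.\<close>
    have L_lt: "L (x n) (l n) c < fopt" if "c > 0" "c \<le> c0 + real n" for c n
      using L_mono[OF xl(2) that] xl(3) by (rule order.strict_trans1)
    have "range p \<subseteq> sublevel_e L A \<Lambda> fopt c0"
      using xl L_lt[OF c0(1)] by (auto simp: sublevel_e_def x_def l_def mem_Times_iff case_prod_unfold)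
    then have "bounded (range p)"
      using c0(2) bounded_subset by blast
    then have "bounded (range x)" "bounded (range l)"
      using bounded_fst[of "range p"] bounded_snd[of "range p"]
      by (simp_all add: x_def l_def image_image)
    \<comment> \<open>Extract first for the points, then for the multipliers, whose space is finite
      dimensional because \<open>'y\<close> is.\<close>
    obtain xs r where r: "strict_mono (r :: nat \<Rightarrow> nat)" "(x \<circ> r) \<longlonglongrightarrow> xs"
      using finite_dimensional_bounded_seq[OF X_fin \<open>bounded (range x)\<close>] .
    have "bounded (range (l \<circ> r))"
      using \<open>bounded (range l)\<close> by (rule bounded_subset) auto
    then obtain ls q where q: "strict_mono (q :: nat \<Rightarrow> nat)" "((l \<circ> r) \<circ> q) \<longlonglongrightarrow> ls"
      using finite_dimensional_bounded_seq[OF finite_dimensional_dual[OF Y_fin]] by blast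
    define s where "s = r \<circ> q"
    have s: "strict_mono s"
      unfolding s_def using r(1) q(1) by (rule strict_mono_o)
    have x_lim: "(\<lambda>n. x (s n)) \<longlonglongrightarrow> xs"
      using LIMSEQ_subseq_LIMSEQ[OF r(2) q(1)] by (simp add: s_def o_def)
    have l_lim: "(\<lambda>n. l (s n)) \<longlonglongrightarrow> ls"
      using q(2) by (simp add: s_def o_def)
    have mem: "xs \<in> A" "ls \<in> \<Lambda>"
      using closed_sequentially[OF A_closed _ x_lim] closed_sequentially[OF \<Lambda>_closed _ l_lim] xl by auto
    have lim: "(\<lambda>n. (x (s n), l (s n))) \<longlonglongrightarrow> (xs, ls)"
      using x_lim l_lim by (rule tendsto_Pair)
    \<comment> \<open>For each fixed \<open>c\<close>, this makes \<open>L_lt\<close> available on a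
      tail of the subsequence.\<close>
    have large: "\<forall>\<^sub>F n in sequentially. c \<le> c0 + real (s n)" for c
    proof -
      have "\<forall>\<^sub>F n in sequentially. c - c0 \<le> real (s n)"
        using filterlim_compose[OF filterlim_real_sequentially filterlim_subseq[OF s]]
        unfolding filterlim_at_top by blast
      then show ?thesis by (rule eventually_mono) simp
    qed
    have "L xs ls c \<le> fopt" if "c > 0" for c
    proof -
      have "\<forall>\<^sub>F n in sequentially. (x (s n), l (s n)) \<in> A \<times> \<Lambda> \<and>
          (case (x (s n), l (s n)) of (x, l) \<Rightarrow> L x l c) \<le> fopt"
        using large[of c] by (rule eventually_mono) (use xl L_lt[OF that] in \<open>auto intro: less_imp_le\<close>)
      then show ?thesis
        using lsc_on_le_of_seq[OF lsc[OF that] lim] mem by simp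
    qed
    then have opt: "xs \<in> \<Omega>" "\<eta> xs ls = 0"
      using limit_optimal mem by blast+
    then obtain c1 U where U: "c1 > 0" "open U" "(xs, ls) \<in> U"
      "\<And>x l c. (x, l) \<in> U \<Longrightarrow> x \<in> A \<Longrightarrow> l \<in> \<Lambda> \<Longrightarrow> c \<ge> c1 \<Longrightarrow> L x l c \<ge> L xs ls c"
      using R mem(2) unfolding locally_exact_def by fastforce
    have "\<forall>\<^sub>F n in sequentially. (x (s n), l (s n)) \<in> U"
      using lim U(2,3) by (rule topological_tendstoD)
    \<comment> \<open>Both sides are compared at the single parameter \<open>c1\<close>:
      \<open>L_lt\<close> puts this point strictly below \<open>fopt\<close>, local exactness puts
      it at or above \<open>L xs ls c1 = fopt\<close>.\<close>
    then obtain n where n: "(x (s n), l (s n)) \<in> U" "c1 \<le> c0 + real (s n)"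
      using eventually_happens[OF eventually_conj[OF _ large[of c1]]] by auto
    have "L xs ls c1 \<le> L (x (s n)) (l (s n)) c1"
      using U(4) n xl by blast
    with L_lt[OF U(1) n(2)] L_opt[OF opt(1) mem(2) opt(2) U(1)] show False
      by simp
  qed

  \<comment> \<open>Sufficiency: minimizers beyond an empty sublevel set\<close>
  then obtain c where c: "c > 0" "sublevel_e L A \<Lambda> fopt c = {}"
    by blast
  have lower: "fopt \<le> L x l c" if "x \<in> A" "l \<in> \<Lambda>" for x l
    using c(2) that by (force simp: sublevel_e_def not_less)
  have "(x, l) \<in> arg_min_set (\<lambda>(x, l). L x l c') (A \<times> \<Lambda>) \<longleftrightarrow> x \<in> \<Omega> \<and> \<eta> x l = 0"
    if xl: "x \<in> A" "l \<in> \<Lambda>" and c': "c' > c" for x l c'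
  proof
    assume "x \<in> \<Omega> \<and> \<eta> x l = 0"
    then have "L x l c' = fopt"
      using L_opt xl c' c(1) by simp
    moreover have "fopt \<le> L x' l' c'" if "x' \<in> A" "l' \<in> \<Lambda>" for x' l'
      using lower[OF that] L_mono[OF that(2) c(1), of c'] c' by (meson less_imp_le order_trans)
    ultimately show "(x, l) \<in> arg_min_set (\<lambda>(x, l). L x l c') (A \<times> \<Lambda>)"
      using argmin_iff xl by simp
  next
    assume "(x, l) \<in> arg_min_set (\<lambda>(x, l). L x l c') (A \<times> \<Lambda>)"
    then have "L x l c' \<le> L xb lb c'"
      using argmin_iff b \<Omega>_iff by blast
    then have "L x l c' \<le> fopt"
      using L_opt[OF b, of c'] c(1) c' by simp
    moreover have "L x l c \<le> L x l c'"
      using L_mono xl(2) c(1) c' by simp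
    \<comment> \<open>Squeezing between \<open>lower\<close> and the value at
      \<open>(xb, lb)\<close> keeps the Lagrangian constant from \<open>c\<close> to
      \<open>c'\<close>.\<close>
    ultimately have eq: "L x l c = fopt" "L x l c' = fopt"
      using lower[OF xl] by auto
    obtain a p e where ape: "f x = ereal a" "\<Phi> (G x) l c = ereal p" "\<eta> x l = ereal e" "e \<ge> 0"
      using ereal_sum3_le_real[of "f x" "\<Phi> (G x) l c" "\<eta> x l" v] eq(1) f_ninf \<Phi>_ninf[OF c(1)] \<eta>_nonneg
      unfolding L_eq v by (metis order.refl)
    \<comment> \<open>The finite terms \<open>f x\<close> and \<open>\<eta> x l\<close> cancel.
      Since \<open>c' > c\<close>, equality excludes strict increase at \<open>c\<close>, and
      (A4)\<open>\<^sub>s\<close> leaves \<open>\<Phi> = 0\<close> and feasibility.\<close>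
    have "\<Phi> (G x) l c' = \<Phi> (G x) l c"
      using eq ape unfolding L_eq v by (cases "\<Phi> (G x) l c'") auto
    then have "\<not> (\<forall>\<tau>>c. \<Phi> (G x) l \<tau> > \<Phi> (G x) l c)"
      using c' by auto
    moreover have "\<Phi> (G x) l c < \<infinity>"
      using ape by simp
    ultimately have \<Phi>0: "\<Phi> (G x) l c = 0" "G x \<in> K"
      using A4 xl(2) c(1) unfolding assm_A4s_def by blast+
    have "v \<le> a"
      using fopt_le[OF xl(1) \<Phi>0(2)] v ape by simp
    moreover have "a + e = v"
      using eq(1) ape \<Phi>0(1) unfolding L_eq v by simp
    ultimately have "e = 0" "a = v"
      using ape(4) by auto
    then show "x \<in> \<Omega> \<and> \<eta> x l = 0"
      using \<Omega>_iff xl(1) \<Phi>0(2) ape v by simp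
  qed
  \<comment> \<open>The pair \<open>(xb, lb)\<close> from the first condition is a
    minimizer.\<close>
  moreover from this have "arg_min_set (\<lambda>(x, l). L x l c') (A \<times> \<Lambda>) \<noteq> {}" if "c' > c" for c'
    using that b \<Omega>_iff by blast
  \<comment> \<open>The characterization holds strictly above \<open>c\<close>, hence the threshold
    \<open>c + 1\<close>.\<close>
  ultimately show "globally_exact L A \<Lambda> \<Omega> \<eta>"
    unfolding globally_exact_def using c(1) by (intro exI[of _ "c + 1"]) auto
qed

end
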